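(* Let $\mathcal G$ (resp. $\mathcal F$) be the space of lower semicontinuous functions over a Hausdorff topological space $X$ (resp. $Y$) with values in $[-\infty,+\infty]$. Then every (max,+)-isomorphism $J$ from $\mathcal F$ onto $\mathcal G$ is of the form $$Jf(x)=g(x)+f(\phi(x))$$ where $g:X\to\mathbb R$ is a continuous function and $\phi:X\to Y$ is a homeomorphism. For $X$ and $Y$ compact, the same holds if lower semicontinuous functions are replaced by continuous (real-valued) functions, or if the lower semicontinuous functions are restricted to be proper.
   Context: A function $f:X\to[-\infty,+\infty]$ is lower semicontinuous if its epigraph is closed in $X\times[-\infty,+\infty]$. A function is proper if it does not take the value $-\infty$ and is not identically $+\infty$. Functions are ordered pointwise. A (max,+)-isomorphism $J:\mathcal F\to\mathcal G$ is a bijection which commutes with pairwise suprema (when the function space is not stable under pairwise suprema: an order isomorphism, i.e. a bijection with $f\ge f'\Leftrightarrow Jf\ge Jf'$) and satisfies $J(f+\lambda)=Jf+\lambda$ for $\lambda\in\mathbb R$. The spaces $X$ and $Y$ are nonempty. *)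

theory Defs
  imports "HOL-Analysis.Analysis"
begin

definition epigraph :: "('a \<Rightarrow> ereal) \<Rightarrow> ('a \<times> ereal) set" where
  "epigraph f = {(x, t). f x \<le> t}"

definition lsc_functions :: "('a::topological_space \<Rightarrow> ereal) set" where
  "lsc_functions = {f. closed (epigraph f)}"

definition proper_function :: "('a \<Rightarrow> ereal) \<Rightarrow> bool" where
  "proper_function f \<longleftrightarrow> (\<forall>x. f x \<noteq> -\<infinity>) \<and> f \<noteq> (\<lambda>_. \<infinity>)"

definition proper_lsc_functions :: "('a::topological_space \<Rightarrow> ereal) set" where
  "proper_lsc_functions = {f \<in> lsc_functions. proper_function f}"

definition continuous_real_functions :: "('a::topological_space \<Rightarrow> real) set" where
  "continuous_real_functions = {f. continuous_on UNIV f}"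

text \<open>
  In the next three definitions, \<open>c\<close> is the inclusion of the reals into the value type:
  \<open>ereal\<close> for extended-real-valued functions, the identity for real-valued ones.
  The map \<open>J\<close> is only constrained on \<open>F\<close>.
\<close>

definition commutes_with_constants ::
  "(real \<Rightarrow> 'v::plus) \<Rightarrow> ('b \<Rightarrow> 'v) set \<Rightarrow> (('b \<Rightarrow> 'v) \<Rightarrow> ('a \<Rightarrow> 'v)) \<Rightarrow> bool" where
  "commutes_with_constants c F J \<longleftrightarrow>
     (\<forall>f\<in>F. \<forall>r::real. J (\<lambda>y. f y + c r) = (\<lambda>x. J f x + c r))"

text \<open>For spaces stable under pairwise suprema (\<open>sup\<close> on functions is pointwise).\<close>

definition maxplus_iso ::
  "(real \<Rightarrow> 'v::{semilattice_sup,plus}) \<Rightarrow> ('b \<Rightarrow> 'v) set \<Rightarrow> ('a \<Rightarrow> 'v) set \<Rightarrow>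
   (('b \<Rightarrow> 'v) \<Rightarrow> ('a \<Rightarrow> 'v)) \<Rightarrow> bool" where
  "maxplus_iso c F G J \<longleftrightarrow>
     bij_betw J F G \<and>
     (\<forall>f\<in>F. \<forall>f'\<in>F. J (sup f f') = sup (J f) (J f')) \<and>
     commutes_with_constants c F J"

text \<open>
  For spaces not stable under pairwise suprema, such as the proper functions:
  the supremum of two of them may be identically \<open>\<infinity>\<close>.
\<close>

definition maxplus_order_iso ::
  "(real \<Rightarrow> 'v::{order,plus}) \<Rightarrow> ('b \<Rightarrow> 'v) set \<Rightarrow> ('a \<Rightarrow> 'v) set \<Rightarrow>
   (('b \<Rightarrow> 'v) \<Rightarrow> ('a \<Rightarrow> 'v)) \<Rightarrow> bool" where
  "maxplus_order_iso c F G J \<longleftrightarrow>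
     bij_betw J F G \<and>
     (\<forall>f\<in>F. \<forall>f'\<in>F. f \<ge> f' \<longleftrightarrow> J f \<ge> J f') \<and>
     commutes_with_constants c F J"

end

theory Submission
  imports Defs
begin

text \<open>
  For lower semicontinuous functions, the spikes (a real value at one point, \<open>\<infinity>\<close> elsewhere)
  are exactly the functions that are changed by adding 1 and have only comparable majorants,
  so an order isomorphism commuting with constants permutes them; a function is determined by the
  spikes above it. Continuity of \<open>\<phi>\<close> and \<open>g\<close> follows by looking at the images of functions
  that are constant on a closed set and \<open>\<infinity>\<close> outside, and at the images of \<open>0\<close> under
  \<open>J\<close> and its inverse. For proper functions that constant cannot be \<open>- \<infinity>\<close>,
  and compactness is needed to bound \<open>g\<close> from above.

  For continuous functions on a compact space there are no spikes. Instead, for fixed \<open>y\<close>,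
  compactness yields a point \<open>x\<close> where \<open>J f x \<le> f y + d\<close> for all \<open>f\<close>, and Urysohn functions
  show that \<open>J f x\<close> then depends on \<open>f y\<close> only.
\<close>

section \<open>Lower semicontinuous functions\<close>

text \<open>A sublevel set is the preimage of the epigraph under the continuous map taking
  \<open>x\<close> to \<open>(x, r)\<close>. Conversely, a real \<open>s\<close> strictly between
  \<open>t\<close> and \<open>f x\<close> yields an open box around \<open>(x, t)\<close> that
  misses the epigraph.\<close>

lemma lsc_functions_iff:
  "f \<in> lsc_functions \<longleftrightarrow> (\<forall>r::real. closed {x. f x \<le> ereal r})"
proof
  assume f: "f \<in> lsc_functions"
  have "closed ((\<lambda>x. (x, ereal r)) -` epigraph f)" for r
    using f by (intro closed_vimage continuous_intros) (simp add: lsc_functions_def)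
  then show "\<forall>r::real. closed {x. f x \<le> ereal r}"
    by (simp add: epigraph_def vimage_def)
next
  assume f: "\<forall>r::real. closed {x. f x \<le> ereal r}"
  have "open (- epigraph f)"
  proof (subst open_subopen, intro ballI)
    fix p assume "p \<in> - epigraph f"
    then obtain x t where p: "p = (x, t)" "t < f x"
      by (cases p) (auto simp: epigraph_def)
    then obtain s where s: "t < ereal s" "ereal s < f x"
      using ereal_dense2 by blast
    let ?T = "(- {x. f x \<le> ereal s}) \<times> {..<ereal s}"
    have "open ?T"
      using f by (intro open_Times) auto
    moreover have "p \<in> ?T" using p s by auto
    moreover have "?T \<subseteq> - epigraph f"
      by (auto simp: epigraph_def)
    ultimately show "\<exists>T. open T \<and> p \<in> T \<and> T \<subseteq> - epigraph f" by blast
  qed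
  then show "f \<in> lsc_functions"
    by (simp add: lsc_functions_def closed_def)
qed

lemma lsc_functions_sup:
  assumes "f \<in> lsc_functions" "f' \<in> lsc_functions"
  shows "sup f f' \<in> lsc_functions"
proof -
  have "{x. sup f f' x \<le> ereal r} = {x. f x \<le> ereal r} \<inter> {x. f' x \<le> ereal r}" for r
    by auto
  then show ?thesis
    using assms by (auto simp: lsc_functions_iff)
qed

lemma ereal_add_real_le_iff: "a + ereal c \<le> ereal r \<longleftrightarrow> a \<le> ereal (r - c)"
  by (cases a) auto

lemma lsc_functions_add_const:
  assumes "f \<in> lsc_functions"
  shows "(\<lambda>x. f x + ereal c) \<in> lsc_functions"
  using assms by (simp add: lsc_functions_iff ereal_add_real_le_iff)

lemma proper_lsc_functions_add_const:
  assumes "f \<in> proper_lsc_functions"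
  shows "(\<lambda>x. f x + ereal c) \<in> proper_lsc_functions"
  using assms lsc_functions_add_const
  by (auto simp: proper_lsc_functions_def proper_function_def fun_eq_iff)

section \<open>Functions constant on a closed set, and spikes\<close>

text \<open>For \<open>r = 0\<close> this is the indicator function of convex analysis. The value is
  an \<open>ereal\<close> so that \<open>- \<infinity>\<close> is available as well.\<close>

definition const_on :: "'a set \<Rightarrow> ereal \<Rightarrow> 'a \<Rightarrow> ereal" where
  "const_on C r = (\<lambda>x. if x \<in> C then r else \<infinity>)"

lemma const_on_lsc:
  assumes "closed C"
  shows "const_on C r \<in> lsc_functions"
proof -
  have "{x. const_on C r x \<le> ereal s} = (if r \<le> ereal s then C else {})" for s
    by (auto simp: const_on_def)
  then show ?thesis
    using assms by (auto simp: lsc_functions_iff)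
qed

lemma const_on_proper_lsc:
  assumes "closed C" "C \<noteq> {}"
  shows "const_on C (ereal r) \<in> proper_lsc_functions"
  using assms const_on_lsc[OF assms(1)]
  by (auto simp: proper_lsc_functions_def proper_function_def const_on_def fun_eq_iff)

abbreviation spike :: "'a \<Rightarrow> real \<Rightarrow> 'a \<Rightarrow> ereal" where
  "spike y r \<equiv> const_on {y} (ereal r)"

lemma spike_proper_lsc: "spike (y::'a::t2_space) r \<in> proper_lsc_functions"
  by (intro const_on_proper_lsc) auto

text \<open>This turns point values into order relations, which \<open>J\<close> transports.\<close>

lemma le_spike_iff: "f \<le> spike y r \<longleftrightarrow> f y \<le> ereal r"
  by (auto simp: le_fun_def const_on_def)

lemma spike_add: "(\<lambda>z. spike y r z + ereal c) = spike y (r + c)"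
  by (auto simp: const_on_def fun_eq_iff)

lemma spike_shift_neq: "(\<lambda>z. spike y r z + ereal 1) \<noteq> spike y r"
  by (auto simp: const_on_def fun_eq_iff)

text \<open>Off \<open>y\<close> a majorant is forced to be \<open>\<infinity>\<close>, so only its
  value at \<open>y\<close> is free, and values are linearly ordered.\<close>

lemma spike_majorants_chain:
  assumes "spike y r \<le> h" "spike y r \<le> h'"
  shows "h \<le> h' \<or> h' \<le> h"
proof -
  have "h z = \<infinity>" "h' z = \<infinity>" if "z \<noteq> y" for z
    using assms that by (auto simp: le_fun_def const_on_def split: if_splits)
  then have "h \<le> h' \<longleftrightarrow> h y \<le> h' y" "h' \<le> h \<longleftrightarrow> h' y \<le> h y"
    unfolding le_fun_def by (metis order_refl)+
  then show ?thesis
    by auto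
qed

text \<open>The hypothesis \<open>shift\<close> provides a point \<open>y\<close> where
  \<open>f\<close> is real; it rules out the constant \<open>\<infinity>\<close> and a spike of
  height \<open>- \<infinity>\<close>, whose majorants are also comparable. If \<open>f\<close> were
  not \<open>\<infinity>\<close> at a second point, spikes at the two points would be incomparable
  majorants.\<close>

lemma chain_majorants_spike:
  fixes f :: "'a::t2_space \<Rightarrow> ereal"
  assumes F: "proper_lsc_functions \<subseteq> F"
    and shift: "(\<lambda>z. f z + ereal 1) \<noteq> f"
    and chain: "\<And>h h'. \<lbrakk>h \<in> F; h' \<in> F; f \<le> h; f \<le> h'\<rbrakk> \<Longrightarrow> h \<le> h' \<or> h' \<le> h"
  shows "\<exists>y r. f = spike y r"
proof -
  obtain y where "f y + ereal 1 \<noteq> f y"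
    using shift by auto
  then obtain r where r: "f y = ereal r"
    by (cases "f y") auto
  have "f z = \<infinity>" if "z \<noteq> y" for z
  proof (rule ccontr)
    assume "f z \<noteq> \<infinity>"
    \<comment> \<open>Only an upper bound is chosen, since \<open>f z\<close> may be
      \<open>- \<infinity>\<close>.\<close>
    then obtain s where s: "f z \<le> ereal s"
      by (cases "f z") auto
    have "spike y r \<le> spike z s \<or> spike z s \<le> spike y r"
      using F r s spike_proper_lsc by (intro chain) (auto simp: le_spike_iff)
    then show False
      using that by (auto simp: le_spike_iff) (auto simp: const_on_def)
  qed
  then have "f = spike y r"
    using r by (auto simp: const_on_def fun_eq_iff)
  then show ?thesis by blast
qed

section \<open>Order isomorphisms commuting with constants\<close>

lemma maxplus_isoD:
  assumes "maxplus_iso c F G J"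
  shows "bij_betw J F G" "\<And>f f'. f \<in> F \<Longrightarrow> f' \<in> F \<Longrightarrow> J (sup f f') = sup (J f) (J f')"
    "\<And>f r. f \<in> F \<Longrightarrow> J (\<lambda>y. f y + c r) = (\<lambda>x. J f x + c r)"
  using assms by (auto simp: maxplus_iso_def commutes_with_constants_def)

lemma maxplus_order_isoD:
  assumes "maxplus_order_iso c F G J"
  shows "bij_betw J F G" "\<And>f f'. f \<in> F \<Longrightarrow> f' \<in> F \<Longrightarrow> J f \<le> J f' \<longleftrightarrow> f \<le> f'"
    "\<And>f r. f \<in> F \<Longrightarrow> J (\<lambda>y. f y + c r) = (\<lambda>x. J f x + c r)"
  using assms by (auto simp: maxplus_order_iso_def commutes_with_constants_def)

text \<open>\<open>f' \<le> f\<close> amounts to \<open>sup f f' = f\<close>, an equation that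
  \<open>J\<close> preserves and, being injective on \<open>F\<close>, reflects.\<close>

lemma maxplus_iso_imp_order_iso:
  assumes J: "maxplus_iso c F G J"
    and sup: "\<And>f f'. f \<in> F \<Longrightarrow> f' \<in> F \<Longrightarrow> sup f f' \<in> F"
  shows "maxplus_order_iso c F G J"
proof -
  have "J f' \<le> J f \<longleftrightarrow> f' \<le> f" if "f \<in> F" "f' \<in> F" for f f'
    using maxplus_isoD(2)[OF J that] sup[OF that] that
      bij_betw_imp_inj_on[OF maxplus_isoD(1)[OF J]]
    by (metis inj_onD sup.absorb_iff1)
  then show ?thesis
    using J by (simp add: maxplus_order_iso_def maxplus_iso_def)
qed

text \<open>With this, every result about \<open>J\<close> yields one about its inverse. By
  \<open>add\<close>, a shifted preimage stays in \<open>F\<close>, where \<open>J\<close> is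
  injective.\<close>

lemma maxplus_order_iso_inv:
  assumes J: "maxplus_order_iso c F G J"
    and add: "\<And>f r. f \<in> F \<Longrightarrow> (\<lambda>y. f y + c r) \<in> F"
  shows "maxplus_order_iso c G F (inv_into F J)"
proof -
  note D = maxplus_order_isoD[OF J]
  have inv: "inv_into F J k \<in> F" "J (inv_into F J k) = k" if "k \<in> G" for k
    using D(1) that by (auto simp: bij_betw_def inv_into_into f_inv_into_f)
  have "inv_into F J (\<lambda>x. k x + c r) = (\<lambda>y. inv_into F J k y + c r)" if "k \<in> G" for k r
  proof -
    have "(\<lambda>x. k x + c r) = J (\<lambda>y. inv_into F J k y + c r)"
      using D(3) inv[OF that] by metis
    then show ?thesis
      using D(1) inv[OF that] add by (simp add: bij_betw_def)
  qed
  moreover have "inv_into F J k' \<le> inv_into F J k \<longleftrightarrow> k' \<le> k" if "k \<in> G" "k' \<in> G" for k k'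
    using D(2) inv that by metis
  ultimately show ?thesis
    using bij_betw_inv_into[OF D(1)]
    by (simp add: maxplus_order_iso_def commutes_with_constants_def)
qed

section \<open>Isomorphisms of spaces of lower semicontinuous functions\<close>

text \<open>An extended real, even an infinite one, is determined by the reals above it.\<close>

lemma ereal_eq_add_if_same_upper_bounds:
  assumes "\<And>r::real. a \<le> ereal r \<longleftrightarrow> b \<le> ereal (c + r)"
  shows "b = ereal c + a"
proof (rule antisym)
  show "b \<le> ereal c + a"
  proof (rule ereal_le_real)
    fix z assume "ereal c + a \<le> ereal z"
    then have "a \<le> ereal (z - c)"
      by (cases a) auto
    then show "b \<le> ereal z"
      using assms[of "z - c"] by simp
  qed
  show "ereal c + a \<le> b"
  proof (rule ereal_le_real)
    fix z assume "b \<le> ereal z"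
    then have "a \<le> ereal (z - c)"
      using assms[of "z - c"] by simp
    then show "ereal c + a \<le> ereal z"
      by (cases a) auto
  qed
qed

text \<open>The image of a spike at \<open>y\<close> is a spike at some \<open>x\<close>. Comparing
  \<open>f\<close> with spikes at \<open>y\<close>, and \<open>J f\<close> with their images, reads
  off both values.\<close>

lemma order_iso_evaluation:
  fixes J :: "('b::t2_space \<Rightarrow> ereal) \<Rightarrow> ('a::t2_space \<Rightarrow> ereal)"
  assumes F: "proper_lsc_functions \<subseteq> F"
    and G: "proper_lsc_functions \<subseteq> G"
    and J: "maxplus_order_iso ereal F G J"
  shows "\<exists>x c. \<forall>f\<in>F. J f x = ereal c + f y"
proof -
  note D = maxplus_order_isoD[OF J]
  have spike: "spike y r \<in> F" for r
    using F spike_proper_lsc by blast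
  \<comment> \<open>All spikes at \<open>y\<close> are shifts of the one of height 0, so their
    images sit at the same point.\<close>
  have JD: "J (spike y r) = (\<lambda>x. J (spike y 0) x + ereal r)" for r
    using D(3)[OF spike, of 0 r] by (simp add: spike_add)
  have "\<exists>x c. J (spike y 0) = spike x c"
  proof (rule chain_majorants_spike[OF G])
    have "J (spike y 1) \<noteq> J (spike y 0)"
      using spike_shift_neq[of y 0] spike bij_betw_imp_inj_on[OF D(1)]
      by (auto simp: spike_add inj_on_def)
    then show "(\<lambda>z. J (spike y 0) z + ereal 1) \<noteq> J (spike y 0)"
      using JD[of 1] by simp
    fix h h' assume h: "h \<in> G" "h' \<in> G" "J (spike y 0) \<le> h" "J (spike y 0) \<le> h'"
    then obtain f f' where f: "f \<in> F" "f' \<in> F" "h = J f" "h' = J f'"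
      using D(1) by (auto simp: bij_betw_def)
    then have "f \<le> f' \<or> f' \<le> f"
      using h D(2)[OF spike] by (intro spike_majorants_chain[of y 0]) auto
    then show "h \<le> h' \<or> h' \<le> h"
      using f D(2) by blast
  qed
  then obtain x c where x: "J (spike y 0) = spike x c" by blast
  have Jx: "J (spike y r) = spike x (c + r)" for r
    by (subst JD) (simp add: x spike_add)
  have "J f x = ereal c + f y" if f: "f \<in> F" for f
    using D(2)[OF f spike] Jx
    by (intro ereal_eq_add_if_same_upper_bounds) (simp add: le_spike_iff)
  then show ?thesis by blast
qed

text \<open>Evaluation for the inverse of \<open>J\<close> produces \<open>\<phi>\<close> and
  \<open>g\<close>; evaluation for \<open>J\<close> itself produces \<open>\<psi>\<close>. Topology
  enters only later.\<close>

lemma order_iso_weighted_composition: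
  fixes J :: "('b::t2_space \<Rightarrow> ereal) \<Rightarrow> ('a::t2_space \<Rightarrow> ereal)"
  assumes F: "proper_lsc_functions \<subseteq> F"
    and G: "proper_lsc_functions \<subseteq> G"
    and add: "\<And>f r. f \<in> F \<Longrightarrow> (\<lambda>y. f y + ereal r) \<in> F"
    and J: "maxplus_order_iso ereal F G J"
  shows "\<exists>(g :: 'a \<Rightarrow> real) \<phi> \<psi>. (\<forall>y. \<phi> (\<psi> y) = y) \<and> (\<forall>x. \<psi> (\<phi> x) = x) \<and>
           (\<forall>f\<in>F. \<forall>x. J f x = ereal (g x) + f (\<phi> x))"
proof -
  note D = maxplus_order_isoD[OF J]
  have "\<exists>c y. \<forall>f\<in>F. J f x = ereal c + f y" for x
  proof -
    obtain y c where *: "\<forall>k\<in>G. inv_into F J k y = ereal c + k x"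
      using order_iso_evaluation[OF G F maxplus_order_iso_inv[OF J add]] by blast
    have "J f x = ereal (- c) + f y" if f: "f \<in> F" for f
    proof -
      have "f y = ereal c + J f x"
        using * f D(1) by (metis bij_betw_inv_into_left bij_betwE)
      then show ?thesis by (cases "J f x") auto
    qed
    then show ?thesis by blast
  qed
  then obtain g \<phi> where \<phi>: "\<And>f x. f \<in> F \<Longrightarrow> J f x = ereal (g x) + f (\<phi> x)"
    by metis
  obtain c \<psi> where \<psi>: "\<And>f y. f \<in> F \<Longrightarrow> J f (\<psi> y) = ereal (c y) + f y"
    using order_iso_evaluation[OF F G J] by metis
  \<comment> \<open>Both formulas for \<open>J (spike y 0) (\<psi> y)\<close> must be finite, and
    the spike is finite only at \<open>y\<close>.\<close>
  have 1: "\<phi> (\<psi> y) = y" for y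
  proof -
    have "spike y 0 \<in> F"
      using F spike_proper_lsc by blast
    from \<phi>[OF this, of "\<psi> y"] \<psi>[OF this, of y] show ?thesis
      by (auto simp: const_on_def split: if_splits)
  qed
  \<comment> \<open>The same finiteness argument, applied to the preimage of a spike at
    \<open>x\<close>.\<close>
  have 2: "\<psi> (\<phi> x) = x" for x
  proof -
    have "spike x 0 \<in> G"
      using G spike_proper_lsc by blast
    then obtain f where f: "f \<in> F" "spike x 0 = J f"
      using D(1) by (auto simp: bij_betw_def)
    have "J f x \<noteq> \<infinity>"
      using f(2)[symmetric] by (simp add: const_on_def)
    then have "f (\<phi> x) \<noteq> \<infinity>"
      using \<phi>[OF f(1), of x] by auto
    then have "J f (\<psi> (\<phi> x)) \<noteq> \<infinity>"
      using \<psi>[OF f(1), of "\<phi> x"] by auto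
    then show ?thesis
      using f(2)[symmetric] by (auto simp: const_on_def split: if_splits)
  qed
  show ?thesis
    using 1 2 \<phi> by blast
qed

section \<open>Continuity of the weight and of the point map\<close>

lemma continuous_on_if_lsc:
  fixes g :: "'a::topological_space \<Rightarrow> real"
  assumes "(\<lambda>x. ereal (g x)) \<in> lsc_functions" "(\<lambda>x. ereal (- g x)) \<in> lsc_functions"
  shows "continuous_on UNIV g"
proof -
  have le: "closed {x. g x \<le> r}" for r
    using assms(1) by (simp add: lsc_functions_iff)
  have ge: "closed {x. r \<le> g x}" for r
  proof -
    have "closed {x. - g x \<le> - r}"
      using assms(2) unfolding lsc_functions_iff by (simp only: ereal_less_eq)
    then show ?thesis by simp
  qed
  have "open {x. r < g x}" "open {x. g x < r}" for r
    using le[of r] ge[of r] by (auto simp: closed_def Compl_eq not_le)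
  then have "(g \<longlongrightarrow> g x) (at x)" for x
    by (intro order_tendstoI) (fastforce simp: eventually_at_topological)+
  then show ?thesis
    by (simp add: continuous_on_def)
qed

text \<open>The image of 0 is \<open>g\<close>, so \<open>g\<close> is lower semicontinuous; the
  preimage of 0, composed with \<open>\<phi>\<close>, is \<open>- g\<close>. The hypotheses
  \<open>closed\<close> are left to the two applications, which establish them differently.\<close>

lemma homeomorphism_and_continuous_weight:
  fixes J :: "('b::t2_space \<Rightarrow> ereal) \<Rightarrow> ('a::t2_space \<Rightarrow> ereal)"
  assumes F: "proper_lsc_functions \<subseteq> F" "F \<subseteq> lsc_functions"
    and G: "proper_lsc_functions \<subseteq> G" "G \<subseteq> lsc_functions"
    and bij: "bij_betw J F G"
    and \<phi>\<psi>: "\<And>y. \<phi> (\<psi> y) = y" "\<And>x. \<psi> (\<phi> x) = x"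
    and J: "\<And>f x. f \<in> F \<Longrightarrow> J f x = ereal (g x) + f (\<phi> x)"
    and closed: "\<And>C. closed C \<Longrightarrow> closed (\<phi> -` C)" "\<And>C. closed C \<Longrightarrow> closed (\<psi> -` C)"
  shows "continuous_on UNIV g \<and> homeomorphism UNIV UNIV \<phi> \<psi>"
proof
  have zero: "(\<lambda>_. 0) \<in> F" "(\<lambda>_. 0) \<in> G"
    using const_on_proper_lsc[OF closed_UNIV, where r = 0] F G by (auto simp: const_on_def zero_ereal_def)
  obtain f where f: "f \<in> F" "J f = (\<lambda>_. 0)"
    using bij zero(2) unfolding bij_betw_def by (metis imageE)
  have f\<phi>: "f (\<phi> x) = ereal (- g x)" for x
    using J[OF f(1), of x] f(2) by (cases "f (\<phi> x)") (auto simp: zero_ereal_def)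
  show "continuous_on UNIV g"
  proof (rule continuous_on_if_lsc)
    have "J (\<lambda>_. 0) = (\<lambda>x. ereal (g x))"
      using J[OF zero(1)] by auto
    then show "(\<lambda>x. ereal (g x)) \<in> lsc_functions"
      using bij zero(1) G by (metis bij_betwE subsetD)
    have "closed (\<phi> -` {y. f y \<le> ereal r})" for r
      using f(1) F(2) by (intro closed(1)) (auto simp: lsc_functions_iff)
    then show "(\<lambda>x. ereal (- g x)) \<in> lsc_functions"
      by (simp add: lsc_functions_iff f\<phi> vimage_def)
  qed
  show "homeomorphism UNIV UNIV \<phi> \<psi>"
    using closed \<phi>\<psi> by (intro homeomorphismI) (auto simp: continuous_on_closed_vimage)
qed

lemma lsc_iso_weighted_composition:
  fixes J :: "('b::t2_space \<Rightarrow> ereal) \<Rightarrow> ('a::t2_space \<Rightarrow> ereal)"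
  assumes "maxplus_iso ereal lsc_functions lsc_functions J"
  shows "\<exists>(g :: 'a \<Rightarrow> real) (\<phi> :: 'a \<Rightarrow> 'b) \<psi>.
          continuous_on UNIV g \<and> homeomorphism UNIV UNIV \<phi> \<psi> \<and>
          (\<forall>f\<in>lsc_functions. \<forall>x. J f x = ereal (g x) + f (\<phi> x))"
proof -
  have J: "maxplus_order_iso ereal lsc_functions lsc_functions J"
    using assms lsc_functions_sup by (rule maxplus_iso_imp_order_iso)
  have sub: "proper_lsc_functions \<subseteq> (lsc_functions :: ('c::t2_space \<Rightarrow> ereal) set)"
    by (auto simp: proper_lsc_functions_def)
  note bij = maxplus_order_isoD(1)[OF J]
  obtain g \<phi> \<psi> where \<phi>\<psi>: "\<And>y. \<phi> (\<psi> y) = y" "\<And>x. \<psi> (\<phi> x) = x"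
    and Jf: "\<And>f x. f \<in> lsc_functions \<Longrightarrow> J f x = ereal (g x) + f (\<phi> x)"
    using order_iso_weighted_composition[OF sub sub lsc_functions_add_const J] by metis
  have 1: "closed (\<phi> -` C)" if "closed C" for C
  proof -
    \<comment> \<open>The values \<open>- \<infinity>\<close> and \<open>\<infinity>\<close> absorb
      the real weight \<open>g x\<close>, on which no bound is known. Any real level would do in
      place of 0.\<close>
    have "J (const_on C (- \<infinity>)) \<in> lsc_functions"
      using bij const_on_lsc[OF that] by (metis bij_betwE)
    then have "closed {x. J (const_on C (- \<infinity>)) x \<le> ereal 0}"
      unfolding lsc_functions_iff by blast
    also have "{x. J (const_on C (- \<infinity>)) x \<le> ereal 0} = \<phi> -` C"
      using Jf[OF const_on_lsc[OF that]] by (auto simp: const_on_def)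
    finally show ?thesis .
  qed
  have 2: "closed (\<psi> -` C)" if "closed C" for C
  proof -
    obtain f where f: "f \<in> lsc_functions" "J f = const_on C (- \<infinity>)"
      using bij const_on_lsc[OF \<open>closed C\<close>] unfolding bij_betw_def by (metis imageE)
    \<comment> \<open>Since \<open>J f\<close> has only infinite values and the weight is real,
      \<open>f\<close> has only infinite values too.\<close>
    have "f y \<le> ereal 0 \<longleftrightarrow> \<psi> y \<in> C" for y
      using Jf[OF f(1), of "\<psi> y"] \<phi>\<psi>
      by (cases "f y") (auto simp: f(2) const_on_def split: if_splits)
    then have "\<psi> -` C = {y. f y \<le> ereal 0}"
      by auto
    then show ?thesis
      using f(1) by (simp add: lsc_functions_iff)
  qed
  show ?thesis
    using homeomorphism_and_continuous_weight[OF sub subset_refl sub subset_refl bij \<phi>\<psi> Jf 1 2] Jf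
    by blast
qed

section \<open>Proper functions on compact spaces\<close>

text \<open>The open sets where \<open>f\<close> exceeds \<open>- n\<close> cover the space, and a
  finite subcover gives the bound.\<close>

lemma lsc_bounded_below_on_compact:
  fixes f :: "'a::topological_space \<Rightarrow> ereal"
  assumes "compact (UNIV :: 'a set)" "f \<in> lsc_functions" "\<And>x. f x \<noteq> - \<infinity>"
  shows "\<exists>m::real. \<forall>x. ereal m < f x"
proof -
  have "UNIV \<subseteq> (\<Union>n::nat. {x. ereal (- real n) < f x})"
  proof
    fix x
    obtain n :: nat where "ereal (- real n) < f x"
    proof (cases "f x")
      case (real r)
      then obtain n :: nat where "- r < real n"
        using reals_Archimedean2 by blast
      then show ?thesis using that[of n] real by simp
    qed (use assms(3) that[of 0] in auto)
    then show "x \<in> (\<Union>n::nat. {x. ereal (- real n) < f x})" by blast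
  qed
  moreover have "\<And>n. n \<in> UNIV \<Longrightarrow> open {x. ereal (- real n) < f x}"
    using assms(2) by (simp add: lsc_functions_iff closed_def Compl_eq not_le del: ereal_uminus_le_reorder)
  ultimately obtain N where N: "finite N" "UNIV \<subseteq> (\<Union>n\<in>N. {x. ereal (- real n) < f x})"
    by - (rule compactE_image[OF assms(1), of UNIV "\<lambda>n. {x. ereal (- real n) < f x}"])
  have "ereal (- real (Max N)) < f x" for x
  proof -
    obtain n where n: "n \<in> N" "ereal (- real n) < f x"
      using N(2) by blast
    have "ereal (- real (Max N)) \<le> ereal (- real n)"
      using N(1) n(1) by simp
    then show ?thesis
      using n(2) by (rule le_less_trans)
  qed
  then show ?thesis by blast
qed

lemma proper_lsc_iso_weighted_composition:
  fixes J :: "('b::t2_space \<Rightarrow> ereal) \<Rightarrow> ('a::t2_space \<Rightarrow> ereal)"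
  assumes compact: "compact (UNIV :: 'a set)" "compact (UNIV :: 'b set)"
    and J: "maxplus_order_iso ereal proper_lsc_functions proper_lsc_functions J"
  shows "\<exists>(g :: 'a \<Rightarrow> real) (\<phi> :: 'a \<Rightarrow> 'b) \<psi>.
          continuous_on UNIV g \<and> homeomorphism UNIV UNIV \<phi> \<psi> \<and>
          (\<forall>f\<in>proper_lsc_functions. \<forall>x. J f x = ereal (g x) + f (\<phi> x))"
proof -
  have sub: "proper_lsc_functions \<subseteq> (lsc_functions :: ('c::t2_space \<Rightarrow> ereal) set)"
    by (auto simp: proper_lsc_functions_def)
  note bij = maxplus_order_isoD(1)[OF J]
  obtain g \<phi> \<psi> where \<phi>\<psi>: "\<And>y. \<phi> (\<psi> y) = y" "\<And>x. \<psi> (\<phi> x) = x"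
    and Jf: "\<And>f x. f \<in> proper_lsc_functions \<Longrightarrow> J f x = ereal (g x) + f (\<phi> x)"
    using order_iso_weighted_composition[OF subset_refl subset_refl proper_lsc_functions_add_const J]
    by metis
  have zero: "(\<lambda>_. 0) \<in> proper_lsc_functions"
    using const_on_proper_lsc[OF closed_UNIV, where r = 0]
    by (auto simp: const_on_def zero_ereal_def)
  obtain f where f: "f \<in> proper_lsc_functions" "J f = (\<lambda>_. 0)"
    using bij zero unfolding bij_betw_def by (metis imageE)
  have "f y \<noteq> - \<infinity>" for y
    using f(1) by (simp add: proper_lsc_functions_def proper_function_def)
  then obtain m where m: "\<And>y. ereal m < f y"
    using lsc_bounded_below_on_compact[OF compact(2)] f(1) sub by blast
  \<comment> \<open>\<open>J f = 0\<close> means that \<open>f (\<phi> x) = - g x\<close>, so a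
    lower bound for \<open>f\<close> bounds \<open>g\<close> from above.\<close>
  have g: "g x \<le> - m" for x
    using Jf[OF f(1), of x] m[of "\<phi> x"] by (cases "f (\<phi> x)") (auto simp: f(2) zero_ereal_def)
  have 1: "closed (\<phi> -` C)" if "closed C" for C
  \<comment> \<open>For empty \<open>C\<close> the function \<open>const_on C (ereal 0)\<close> is
    identically \<open>\<infinity>\<close>, hence not proper.\<close>
  proof (cases "C = {}")
    case False
    let ?f = "const_on C (ereal 0)"
    have cl: "?f \<in> proper_lsc_functions"
      using const_on_proper_lsc[OF that False] .
    then have "J ?f \<in> lsc_functions"
      using bij sub by (metis bij_betwE subsetD)
    then have "closed {x. J ?f x \<le> ereal (- m)}"
      unfolding lsc_functions_iff by blast
    \<comment> \<open>The image is \<open>g\<close> on the preimage of \<open>C\<close> and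
      \<open>\<infinity>\<close> elsewhere; the level \<open>- m\<close> catches all values of
      \<open>g\<close>.\<close>
    also have "{x. J ?f x \<le> ereal (- m)} = \<phi> -` C"
      using Jf[OF cl] g by (auto simp: const_on_def)
    finally show ?thesis .
  qed simp
  have "continuous_on UNIV \<phi>"
    using 1 by (simp add: continuous_on_closed_vimage)
  \<comment> \<open>A continuous injection from a compact space into a Hausdorff space has a
    continuous inverse on its range.\<close>
  then have "continuous_on (range \<phi>) \<psi>"
    using compact(1) \<phi>\<psi> by (intro continuous_on_inv) auto
  moreover have "range \<phi> = UNIV"
    using \<phi>\<psi>(1) by (metis surjI)
  ultimately have 2: "closed (\<psi> -` C)" if "closed C" for C
    using that by (simp add: continuous_on_closed_vimage)
  show ?thesis
    using homeomorphism_and_continuous_weight[OF subset_refl sub subset_refl sub bij \<phi>\<psi> Jf 1 2] Jf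
    by blast
qed

section \<open>Isomorphisms of spaces of continuous functions\<close>

lemma compact_Hausdorff_urysohn:
  fixes y :: "'a::t2_space"
  assumes "compact (UNIV :: 'a set)" "closed C" "y \<notin> C"
  shows "\<exists>u :: 'a \<Rightarrow> real. continuous_on UNIV u \<and> u y = 0 \<and> (\<forall>z\<in>C. u z = 1)"
proof -
  have "Hausdorff_space (euclidean :: 'a topology)"
    unfolding Hausdorff_space_def disjnt_def by (metis hausdorff open_openin)
  moreover have "compact_space (euclidean :: 'a topology)"
    using assms(1) by (simp add: compact_space_def)
  ultimately have "completely_regular_space (euclidean :: 'a topology)"
    by (simp add: compact_Hausdorff_or_regular_imp_normal_space normal_imp_completely_regular_space)
  then have "\<exists>u :: 'a \<Rightarrow> real. continuous_map euclidean euclideanreal u \<and> u y = 0 \<and> u ` C \<subseteq> {1}"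
    using assms(2,3) by (simp add: completely_regular_space_alt)
  then show ?thesis
    by (simp add: image_subset_iff)
qed

lemma continuous_real_functions_sup:
  "f \<in> continuous_real_functions \<Longrightarrow> f' \<in> continuous_real_functions \<Longrightarrow>
   sup f f' \<in> continuous_real_functions"
  by (auto simp: continuous_real_functions_def sup_fun_def sup_max intro!: continuous_on_max)

lemma continuous_real_functions_add_const:
  "f \<in> continuous_real_functions \<Longrightarrow> (\<lambda>x. f x + c) \<in> continuous_real_functions"
  by (auto simp: continuous_real_functions_def intro!: continuous_intros)

lemma zero_continuous_real_functions: "(\<lambda>_. 0) \<in> continuous_real_functions"
  by (simp add: continuous_real_functions_def)

text \<open>Taking suprema keeps the value at \<open>y\<close> nonpositive; this merges the finitely
  many functions of a subcover into one.\<close>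

lemma common_continuous_majorant:
  assumes "finite S" "S \<subseteq> {f \<in> continuous_real_functions. f y \<le> 0}"
  shows "\<exists>f \<in> continuous_real_functions. f y \<le> 0 \<and> (\<forall>h\<in>S. h \<le> f)"
  using assms
proof induction
  case empty
  then show ?case
    using zero_continuous_real_functions by force
next
  case (insert k S)
  then obtain f where "f \<in> continuous_real_functions" "f y \<le> 0" "\<forall>h\<in>S. h \<le> f"
    by auto
  with insert.prems show ?case
    by (intro bexI[of _ "sup k f"] continuous_real_functions_sup) (auto simp: le_fun_def intro: le_supI2)
qed

text \<open>Otherwise every point has some \<open>f\<close> with \<open>f y \<le> 0\<close> and
  \<open>J f\<close> above \<open>J 0 + 1\<close> there. By compactness a single such
  \<open>f\<close> satisfies \<open>J f \<ge> J 0 + 1 = J 1\<close> everywhere, so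
  \<open>f \<ge> 1\<close>, which fails at \<open>y\<close>.\<close>

lemma order_iso_continuous_dominated:
  fixes J :: "('b::t2_space \<Rightarrow> real) \<Rightarrow> ('a::t2_space \<Rightarrow> real)"
  assumes compact: "compact (UNIV :: 'a set)"
    and J: "maxplus_order_iso (\<lambda>r. r) continuous_real_functions continuous_real_functions J"
  shows "\<exists>x d. \<forall>f\<in>continuous_real_functions. J f x \<le> f y + d"
proof -
  note D = maxplus_order_isoD[OF J]
  have J_in: "J f \<in> continuous_real_functions" if "f \<in> continuous_real_functions" for f
    using D(1) that by (rule bij_betw_apply)
  let ?I = "{f \<in> continuous_real_functions. f y \<le> 0}"
  let ?U = "\<lambda>f. {x. J (\<lambda>_. 0) x + 1 < J f x}"
  have "\<exists>x. \<forall>f\<in>?I. J f x \<le> J (\<lambda>_. 0) x + 1"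
  proof (rule ccontr)
    assume "\<nexists>x. \<forall>f\<in>?I. J f x \<le> J (\<lambda>_. 0) x + 1"
    then have "UNIV \<subseteq> (\<Union>f\<in>?I. ?U f)"
      by (auto simp: not_le)
    moreover have "open (?U f)" if "f \<in> ?I" for f
      using J_in[of f] J_in[OF zero_continuous_real_functions] that
      by (intro open_Collect_less continuous_intros) (auto simp: continuous_real_functions_def)
    ultimately obtain S where S: "S \<subseteq> ?I" "finite S" "UNIV \<subseteq> (\<Union>f\<in>S. ?U f)"
      using compactE_image[OF compact, of ?I ?U] by blast
    then obtain f where f: "f \<in> continuous_real_functions" "f y \<le> 0" "\<forall>h\<in>S. h \<le> f"
      using common_continuous_majorant by blast
    have "J (\<lambda>_. 0) x + 1 \<le> J f x" for x
    proof -
      obtain h where h: "h \<in> S" "J (\<lambda>_. 0) x + 1 < J h x"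
        using S(3) by blast
      then have "J h \<le> J f"
        using f S(1) D(2) by blast
      then show ?thesis
        using h(2) by (meson le_funD less_le_trans less_imp_le)
    qed
    then have "J (\<lambda>_. 0 + 1) \<le> J f"
      by (subst D(3)[OF zero_continuous_real_functions, of 1]) (rule le_funI)
    then have "(\<lambda>_. 0 + 1) \<le> f"
      using D(2) f(1) continuous_real_functions_add_const[OF zero_continuous_real_functions] by blast
    then show False
      using f(2) by (auto simp: le_fun_def dest: spec[of _ y])
  qed
  then obtain x where x: "\<And>f. f \<in> ?I \<Longrightarrow> J f x \<le> J (\<lambda>_. 0) x + 1"
    by blast
  \<comment> \<open>Subtracting \<open>f y\<close> from \<open>f\<close> brings it into
    \<open>?I\<close>.\<close>
  have "J f x \<le> f y + (J (\<lambda>_. 0) x + 1)" if f: "f \<in> continuous_real_functions" for f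
    using x[of "\<lambda>z. f z + (- f y)"] continuous_real_functions_add_const[OF f, of "- f y"]
      D(3)[OF f, of "- f y"] by simp
  then show ?thesis by blast
qed

text \<open>
  If \<open>f y \<le> f' y\<close>, then \<open>f\<close> lies below the supremum of \<open>f' + e\<close> and a function that is very
  negative at \<open>y\<close>; the latter is negligible because \<open>J k x \<le> k y + d\<close>.
\<close>

lemma evaluation_mono:
  fixes J :: "('b::t2_space \<Rightarrow> real) \<Rightarrow> ('a::t2_space \<Rightarrow> real)"
  assumes compact: "compact (UNIV :: 'b set)"
    and J: "maxplus_iso (\<lambda>r. r) continuous_real_functions continuous_real_functions J"
    and dom: "\<forall>f\<in>continuous_real_functions. J f x \<le> f y + d"
    and f: "f \<in> continuous_real_functions" "f' \<in> continuous_real_functions" "f y \<le> f' y"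
  shows "J f x \<le> J f' x"
proof (rule field_le_epsilon)
  fix e :: real assume e: "0 < e"
  note D = maxplus_isoD[OF J]
  let ?C = "{z. f' z + e \<le> f z}"
  have cont: "continuous_on UNIV f" "continuous_on UNIV f'"
    using f by (auto simp: continuous_real_functions_def)
  then have "closed ?C"
    by (intro closed_Collect_le continuous_intros)
  \<comment> \<open>\<open>?C\<close> is where \<open>f' + e\<close> fails to exceed
    \<open>f\<close>; it avoids \<open>y\<close> because \<open>e\<close> is positive.\<close>
  then obtain u :: "'b \<Rightarrow> real" where u: "continuous_on UNIV u" "u y = 0" "\<forall>z\<in>?C. u z = 1"
    using compact_Hausdorff_urysohn[OF compact, of ?C y] f(3) e by auto
  have "bdd_above (range f)"
    using compact_continuous_image[OF cont(1) compact]
    by (simp add: compact_imp_bounded bounded_imp_bdd_above)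
  then obtain M where M: "\<And>z. f z \<le> M"
    by (auto simp: bdd_above_def)
  \<comment> \<open>Chosen so that \<open>k y + d = J f' x\<close>. The function \<open>k\<close>
    takes the value \<open>N\<close> at \<open>y\<close> and rises or falls to the bound
    \<open>M\<close> on \<open>?C\<close>, where it must dominate \<open>f\<close>.\<close>
  define N where "N = J f' x - d"
  define k where "k = (\<lambda>z. N + (M - N) * u z)"
  have k: "k \<in> continuous_real_functions" "k y = N" "\<And>z. z \<in> ?C \<Longrightarrow> k z = M"
    using u by (auto simp: k_def continuous_real_functions_def intro!: continuous_intros)
  have f'e: "(\<lambda>z. f' z + e) \<in> continuous_real_functions"
    using f(2) by (rule continuous_real_functions_add_const)
  have "f \<le> sup (\<lambda>z. f' z + e) k"
  proof (rule le_funI)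
    fix z
    show "f z \<le> sup (\<lambda>z. f' z + e) k z"
      using M[of z] k(3)[of z] by (cases "z \<in> ?C") (auto simp: sup_max)
  qed
  then have "J f \<le> J (sup (\<lambda>z. f' z + e) k)"
    using maxplus_order_isoD(2)[OF maxplus_iso_imp_order_iso[OF J continuous_real_functions_sup]]
      f(1) continuous_real_functions_sup[OF f'e k(1)] by blast
  also have "\<dots> = sup (\<lambda>x. J f' x + e) (J k)"
    using D(2)[OF f'e k(1)] D(3)[OF f(2)] by simp
  finally have "J f x \<le> max (J f' x + e) (J k x)"
    by (simp add: le_fun_def sup_max)
  moreover have "J k x \<le> J f' x"
    using dom k(1,2) by (auto simp: N_def)
  ultimately show "J f x \<le> J f' x + e"
    using e by simp
qed

text \<open>Monotonicity in both directions shows that \<open>J f x\<close> depends only on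
  \<open>f y\<close>, so \<open>f\<close> may be replaced by the constant \<open>f y\<close>, a
  shift of 0.\<close>

lemma iso_continuous_evaluation:
  fixes J :: "('b::t2_space \<Rightarrow> real) \<Rightarrow> ('a::t2_space \<Rightarrow> real)"
  assumes compact: "compact (UNIV :: 'a set)" "compact (UNIV :: 'b set)"
    and J: "maxplus_iso (\<lambda>r. r) continuous_real_functions continuous_real_functions J"
  shows "\<exists>x. \<forall>f\<in>continuous_real_functions. J f x = J (\<lambda>_. 0) x + f y"
proof -
  obtain x d where dom: "\<forall>f\<in>continuous_real_functions. J f x \<le> f y + d"
    using order_iso_continuous_dominated[OF compact(1)
        maxplus_iso_imp_order_iso[OF J continuous_real_functions_sup]] by blast
  have "J f x = J (\<lambda>_. 0) x + f y" if f: "f \<in> continuous_real_functions" for f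
  proof -
    have c: "(\<lambda>_. 0 + f y) \<in> continuous_real_functions"
      using continuous_real_functions_add_const[OF zero_continuous_real_functions] .
    have "J f x = J (\<lambda>_. 0 + f y) x"
      using evaluation_mono[OF compact(2) J dom f c] evaluation_mono[OF compact(2) J dom c f]
      by simp
    also have "\<dots> = J (\<lambda>_. 0) x + f y"
      by (simp only: maxplus_isoD(3)[OF J zero_continuous_real_functions])
    finally show ?thesis .
  qed
  then show ?thesis by blast
qed

text \<open>Needed for the inverse of \<open>J\<close>, which arises as an order isomorphism. By
  surjectivity \<open>sup (J f) (J f')\<close> is some \<open>J h\<close>, and \<open>h\<close> is
  an upper bound of \<open>f\<close> and \<open>f'\<close>.\<close>

lemma maxplus_order_iso_imp_iso_continuous:
  assumes "maxplus_order_iso c continuous_real_functions continuous_real_functions J"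
  shows "maxplus_iso c continuous_real_functions continuous_real_functions J"
proof -
  note D = maxplus_order_isoD[OF assms]
  have "J (sup f f') = sup (J f) (J f')"
    if f: "f \<in> continuous_real_functions" "f' \<in> continuous_real_functions" for f f'
  proof (rule antisym)
    have Jf: "J f \<in> continuous_real_functions" "J f' \<in> continuous_real_functions"
      using bij_betw_apply[OF D(1)] f by auto
    obtain h where h: "h \<in> continuous_real_functions" "J h = sup (J f) (J f')"
      using D(1) continuous_real_functions_sup[OF Jf] unfolding bij_betw_def by (metis imageE)
    then have "f \<le> h" "f' \<le> h"
      using D(2) f by (metis sup_ge1, metis sup_ge2)
    then show "J (sup f f') \<le> sup (J f) (J f')"
      using D(2)[OF continuous_real_functions_sup[OF f] h(1)] h(2) by simp
    show "sup (J f) (J f') \<le> J (sup f f')"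
      using D(2) f continuous_real_functions_sup[OF f] by simp
  qed
  then show ?thesis
    using assms by (simp add: maxplus_iso_def maxplus_order_iso_def)
qed

text \<open>Testing with 0 gives \<open>c = 0\<close>, and a Urysohn function then separates. The
  constant \<open>c\<close> accommodates a difference of weights.\<close>

lemma continuous_functions_separate:
  fixes y z :: "'a::t2_space"
  assumes "compact (UNIV :: 'a set)"
    and "\<And>f. f \<in> continuous_real_functions \<Longrightarrow> f y = f z + c"
  shows "y = z"
proof (rule ccontr)
  assume "y \<noteq> z"
  then obtain u :: "'a \<Rightarrow> real" where "continuous_on UNIV u" "u y = 0" "u z = 1"
    using compact_Hausdorff_urysohn[OF assms(1), of "{z}" y] by auto
  then show False
    using assms(2)[of u] assms(2)[OF zero_continuous_real_functions]
    by (simp add: continuous_real_functions_def)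
qed

lemma continuous_iso_weighted_composition:
  fixes J :: "('b::t2_space \<Rightarrow> real) \<Rightarrow> ('a::t2_space \<Rightarrow> real)"
  assumes compact: "compact (UNIV :: 'a set)" "compact (UNIV :: 'b set)"
    and J: "maxplus_iso (\<lambda>r. r) continuous_real_functions continuous_real_functions J"
  shows "\<exists>(g :: 'a \<Rightarrow> real) (\<phi> :: 'a \<Rightarrow> 'b) \<psi>.
            continuous_on UNIV g \<and> homeomorphism UNIV UNIV \<phi> \<psi> \<and>
            (\<forall>f\<in>continuous_real_functions. \<forall>x. J f x = g x + f (\<phi> x))"
proof -
  let ?C = "continuous_real_functions"
  let ?K = "inv_into ?C J"
  note D = maxplus_isoD[OF J]
  have K: "maxplus_iso (\<lambda>r. r) ?C ?C ?K"
    by (rule maxplus_order_iso_imp_iso_continuous, rule maxplus_order_iso_inv,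
        rule maxplus_iso_imp_order_iso[OF J continuous_real_functions_sup])
       (auto intro: continuous_real_functions_add_const)
  define g where "g = J (\<lambda>_. 0)"
  have g: "continuous_on UNIV g"
    using bij_betw_apply[OF D(1) zero_continuous_real_functions]
    by (simp add: g_def continuous_real_functions_def)
  obtain \<psi> where \<psi>: "\<And>f y. f \<in> ?C \<Longrightarrow> J f (\<psi> y) = g (\<psi> y) + f y"
    using iso_continuous_evaluation[OF compact J] unfolding g_def by metis
  have "\<exists>y. \<forall>f\<in>?C. J f x = g x + f y" for x
  proof -
    obtain y where "\<forall>k\<in>?C. ?K k y = ?K (\<lambda>_. 0) y + k x"
      using iso_continuous_evaluation[OF compact(2,1) K] by blast
    then have *: "f y = ?K (\<lambda>_. 0) y + J f x" if "f \<in> ?C" for f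
      using D(1) that by (metis bij_betw_inv_into_left bij_betw_apply)
    \<comment> \<open>The case \<open>f = 0\<close> of \<open>*\<close> identifies
      \<open>?K (\<lambda>_. 0) y\<close> as \<open>- g x\<close>.\<close>
    show ?thesis
      using *[OF zero_continuous_real_functions] by (intro exI[of _ y]) (simp add: g_def *)
  qed
  then obtain \<phi> where \<phi>: "\<And>f x. f \<in> ?C \<Longrightarrow> J f x = g x + f (\<phi> x)"
    by metis
  have 1: "\<phi> (\<psi> y) = y" for y
    using \<phi>[of _ "\<psi> y"] \<psi>[of _ y]
    by (intro continuous_functions_separate[OF compact(2), of _ _ 0]) fastforce
  have 2: "\<psi> (\<phi> x) = x" for x
  proof (rule continuous_functions_separate[OF compact(1)])
    fix k :: "'a \<Rightarrow> real" assume "k \<in> ?C"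
    then obtain f where "f \<in> ?C" "k = J f"
      using D(1) by (auto simp: bij_betw_def)
    then show "k (\<psi> (\<phi> x)) = k x + (g (\<psi> (\<phi> x)) - g x)"
      using \<phi>[of f x] \<psi>[of f "\<phi> x"] by simp
  qed
  \<comment> \<open>With \<open>u\<close> equal to 0 at \<open>\<phi> x\<close> and 1 off
    \<open>U\<close>, the function \<open>J u - g\<close>, which is \<open>u\<close> composed with
    \<open>\<phi>\<close>, is continuous; the set where it is below 1 is a neighbourhood of
    \<open>x\<close> inside the preimage of \<open>U\<close>.\<close>
  have "open (\<phi> -` U)" if U: "open U" for U
  proof (subst open_subopen, intro ballI)
    fix x assume "x \<in> \<phi> -` U"
    then obtain u :: "'b \<Rightarrow> real" where u: "continuous_on UNIV u" "u (\<phi> x) = 0" "\<forall>z\<in>-U. u z = 1"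
      using compact_Hausdorff_urysohn[OF compact(2), of "- U" "\<phi> x"] U by (auto simp: closed_def)
    then have uC: "u \<in> ?C"
      by (simp add: continuous_real_functions_def)
    have "continuous_on UNIV (J u)"
      using bij_betw_apply[OF D(1) uC] by (simp add: continuous_real_functions_def)
    then have "open {x'. J u x' < g x' + 1}"
      using g by (intro open_Collect_less continuous_intros)
    moreover have "{x'. J u x' < g x' + 1} = {x'. u (\<phi> x') < 1}"
      using \<phi>[OF uC] by auto
    ultimately show "\<exists>T. open T \<and> x \<in> T \<and> T \<subseteq> \<phi> -` U"
      using u by (intro exI[of _ "{x'. u (\<phi> x') < 1}"]) force
  qed
  then have \<phi>_cont: "continuous_on UNIV \<phi>"
    by (simp add: continuous_on_open_vimage)
  have "continuous_on (range \<phi>) \<psi>"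
    using \<phi>_cont compact(1) 2 by (intro continuous_on_inv) auto
  moreover have "range \<phi> = UNIV"
    using 1 by (metis surjI)
  ultimately have "homeomorphism UNIV UNIV \<phi> \<psi>"
    using \<phi>_cont 1 2 by (intro homeomorphismI) auto
  then show ?thesis
    using g \<phi> by blast
qed

theorem theorem28:
  shows
   "(\<forall>J :: ('b::t2_space \<Rightarrow> ereal) \<Rightarrow> ('a::t2_space \<Rightarrow> ereal).
       maxplus_iso ereal lsc_functions lsc_functions J \<longrightarrow>
       (\<exists>(g :: 'a \<Rightarrow> real) (\<phi> :: 'a \<Rightarrow> 'b) \<psi>.
          continuous_on UNIV g \<and> homeomorphism UNIV UNIV \<phi> \<psi> \<and>
          (\<forall>f\<in>lsc_functions. \<forall>x. J f x = ereal (g x) + f (\<phi> x))))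
    \<and>
    (compact (UNIV :: 'a set) \<and> compact (UNIV :: 'b set) \<longrightarrow>
      (\<forall>J :: ('b \<Rightarrow> real) \<Rightarrow> ('a \<Rightarrow> real).
         maxplus_iso (\<lambda>r. r) continuous_real_functions continuous_real_functions J \<longrightarrow>
         (\<exists>(g :: 'a \<Rightarrow> real) (\<phi> :: 'a \<Rightarrow> 'b) \<psi>.
            continuous_on UNIV g \<and> homeomorphism UNIV UNIV \<phi> \<psi> \<and>
            (\<forall>f\<in>continuous_real_functions. \<forall>x. J f x = g x + f (\<phi> x))))
      \<and>
      (\<forall>J :: ('b \<Rightarrow> ereal) \<Rightarrow> ('a \<Rightarrow> ereal).
         maxplus_order_iso ereal proper_lsc_functions proper_lsc_functions J \<longrightarrow>
         (\<exists>(g :: 'a \<Rightarrow> real) (\<phi> :: 'a \<Rightarrow> 'b) \<psi>.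
            continuous_on UNIV g \<and> homeomorphism UNIV UNIV \<phi> \<psi> \<and>
            (\<forall>f\<in>proper_lsc_functions. \<forall>x. J f x = ereal (g x) + f (\<phi> x)))))"
  by (intro conjI impI allI; (elim conjE)?)
     (rule lsc_iso_weighted_composition continuous_iso_weighted_composition
        proper_lsc_iso_weighted_composition; assumption)+

end
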